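(* Let $P$ be a finite zigzag poset on $[d]$. Then for every edge partition $\ell$ of $P$, the order-chain polytope $\mathcal{OC}_\ell(P)$ is unimodularly equivalent to the chain polytope $\mathcal{C}(Q)$ of some zigzag poset $Q$.
   Context: For a finite poset $(P,\preccurlyeq)$ on $[d]$: the order polytope $\mathcal{O}(P)$ is the set of $x\in\mathbb{R}^d$ with $0\le x_i\le 1$ for all $i$ and $x_i\ge x_j$ whenever $i\preccurlyeq j$. The chain polytope $\mathcal{C}(P)$ is the set of $x\in\mathbb{R}^d$ with $x_i\ge 0$ and $x_{i_1}+\dots+x_{i_k}\le 1$ for every maximal chain $i_1\prec\dots\prec i_k$ of $P$. An edge partition of $P$ is an ordered pair $\ell=(oE(P),cE(P))$ of disjoint sets with union $E(P)$, the edge set of the Hasse diagram of $P$; $P'_\ell$ (resp. $P''_\ell$) is the poset on $[d]$ whose Hasse diagram has edge set $oE(P)$ (resp. $cE(P)$), and $\mathcal{OC}_\ell(P)=\mathcal{O}(P'_\ell)\cap\mathcal{C}(P''_\ell)$. A zigzag poset on $[m]$ is a poset whose cover relations are exactly $1\prec\cdots\prec i_1\succ i_1+1\succ\cdots\succ i_2\prec i_2+1\prec\cdots$, i.e. each pair $\{j,j+1\}$ ($1\le j<m$) is a cover relation in one of the two directions and there are no other cover relations. Two polytopes in $\mathbb{R}^d$ are unimodularly equivalent if there is an affine map $x\mapsto Ux+b$ with $U\in GL_d(\mathbb{Z})$, $b\in\mathbb{Z}^d$, mapping one onto the other. *)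

theory Defs
  imports "Jordan_Normal_Form.Matrix"
begin

text \<open>
  The index set \<open>[d]\<close> is rendered as \<open>{..<d}\<close>, matching the coordinates \<open>x $ i\<close>, \<open>i < d\<close>, of
  a vector \<open>x \<in> carrier_vec d\<close>. A poset on \<open>[d]\<close> is a relation \<open>P\<close> with
  \<open>partial_order_on {..<d} P\<close>, where \<open>(i, j) \<in> P\<close> means \<open>i \<preceq> j\<close>.
\<close>

definition hasse_edges :: "'a rel \<Rightarrow> 'a rel" where
  "hasse_edges P =
     {(i, j). (i, j) \<in> P \<and> i \<noteq> j \<and>
        \<not> (\<exists>k. k \<noteq> i \<and> k \<noteq> j \<and> (i, k) \<in> P \<and> (k, j) \<in> P)}"

definition poset_of_hasse :: "nat \<Rightarrow> nat rel \<Rightarrow> nat rel" where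
  "poset_of_hasse d E = (THE P. partial_order_on {..<d} P \<and> hasse_edges P = E)"

definition zigzag_poset :: "nat \<Rightarrow> nat rel \<Rightarrow> bool" where
  "zigzag_poset m P \<longleftrightarrow>
     partial_order_on {..<m} P \<and>
     (\<forall>j. Suc j < m \<longrightarrow> (j, Suc j) \<in> hasse_edges P \<or> (Suc j, j) \<in> hasse_edges P) \<and>
     (\<forall>(i, j) \<in> hasse_edges P. j = Suc i \<or> i = Suc j)"

definition order_polytope :: "nat \<Rightarrow> nat rel \<Rightarrow> real vec set" where
  "order_polytope d P =
     {x \<in> carrier_vec d. (\<forall>i<d. 0 \<le> x $ i \<and> x $ i \<le> 1) \<and> (\<forall>(i, j) \<in> P. x $ i \<ge> x $ j)}"

definition chain_polytope :: "nat \<Rightarrow> nat rel \<Rightarrow> real vec set" where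
  "chain_polytope d P =
     {x \<in> carrier_vec d. (\<forall>i<d. 0 \<le> x $ i) \<and>
        (\<forall>C. pred_on.maxchain {..<d} (\<lambda>i j. (i, j) \<in> P) C \<longrightarrow> (\<Sum>i\<in>C. x $ i) \<le> 1)}"

definition edge_partition :: "'a rel \<Rightarrow> 'a rel \<times> 'a rel \<Rightarrow> bool" where
  "edge_partition P l \<longleftrightarrow> fst l \<inter> snd l = {} \<and> fst l \<union> snd l = hasse_edges P"

text \<open>The poset \<open>P\<close> enters only through the edge partition \<open>l = (oE(P), cE(P))\<close>.\<close>

definition order_chain_polytope :: "nat \<Rightarrow> nat rel \<times> nat rel \<Rightarrow> real vec set" where
  "order_chain_polytope d l =
     order_polytope d (poset_of_hasse d (fst l)) \<inter> chain_polytope d (poset_of_hasse d (snd l))"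

text \<open>
  Invertibility of \<open>U\<close> is taken over \<open>\<int>\<close>, before the entries are embedded into the reals.
\<close>

definition unimodularly_equivalent :: "nat \<Rightarrow> real vec set \<Rightarrow> real vec set \<Rightarrow> bool" where
  "unimodularly_equivalent d A B \<longleftrightarrow>
     (\<exists>(U :: int mat) \<in> carrier_mat d d. \<exists>(b :: int vec) \<in> carrier_vec d.
        invertible_mat U \<and>
        (\<lambda>x. map_mat real_of_int U *\<^sub>v x + map_vec real_of_int b) ` A = B)"

text \<open>
  The definite description in \<open>poset_of_hasse\<close> is well defined for every subset of the Hasse
  edges of a poset on \<open>{..<d}\<close>.
\<close>

lemma partial_order_on_eq_hasse_closure:
  assumes fin: "finite A" and po: "partial_order_on A P"
  shows "P = Id_on A \<union> (hasse_edges P)\<^sup>+"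
proof -
  have sub: "P \<subseteq> A \<times> A" and rfl: "\<And>x. x \<in> A \<Longrightarrow> (x, x) \<in> P"
    and tr: "trans P" and an: "antisym P"
    using po by (auto simp: partial_order_on_def preorder_on_def refl_on_def)
  have finP: "finite P"
    using finite_subset[OF sub] fin by simp
  have *: "(i, j) \<in> (hasse_edges P)\<^sup>+" if "(i, j) \<in> P" "i \<noteq> j" for i j
    using that
  proof (induction "card {k. (i, k) \<in> P \<and> (k, j) \<in> P}" arbitrary: i j rule: less_induct)
    case less
    show ?case
    proof (cases "(i, j) \<in> hasse_edges P")
      case False
      then obtain k where k: "k \<noteq> i" "k \<noteq> j" "(i, k) \<in> P" "(k, j) \<in> P"
        using less.prems by (auto simp: hasse_edges_def)
      let ?I = "\<lambda>i j. {k. (i, k) \<in> P \<and> (k, j) \<in> P}"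
      have finI: "finite (?I i j)"
        by (rule finite_subset[OF _ fin]) (use sub in auto)
      have mem: "i \<in> A" "j \<in> A"
        using less.prems sub by auto
      have "?I i k \<subset> ?I i j" "?I k j \<subset> ?I i j"
        using k less.prems mem rfl tr an unfolding trans_def antisym_def by blast+
      then have "card (?I i k) < card (?I i j)" "card (?I k j) < card (?I i j)"
        using finI by (auto intro: psubset_card_mono)
      then have "(i, k) \<in> (hasse_edges P)\<^sup>+" "(k, j) \<in> (hasse_edges P)\<^sup>+"
        using less.hyps[of i k] less.hyps[of k j] k by simp_all
      then show ?thesis
        by (rule trancl_trans)
    next
      case True
      then show ?thesis by (rule r_into_trancl)
    qed
  qed
  have "(hasse_edges P)\<^sup>+ \<subseteq> P\<^sup>+"
    by (rule trancl_mono_subset) (auto simp: hasse_edges_def)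
  then have "(hasse_edges P)\<^sup>+ \<subseteq> P"
    using tr by (simp add: trancl_id)
  moreover have "Id_on A \<subseteq> P"
    using rfl by auto
  moreover have "P \<subseteq> Id_on A \<union> (hasse_edges P)\<^sup>+"
  proof (rule subrelI)
    fix i j assume ij: "(i, j) \<in> P"
    show "(i, j) \<in> Id_on A \<union> (hasse_edges P)\<^sup>+"
    proof (cases "i = j")
      case True
      with ij sub show ?thesis by auto
    next
      case False
      with * ij show ?thesis by simp
    qed
  qed
  ultimately show ?thesis by (intro equalityI Un_least)
qed

lemma poset_of_hasse_eq:
  assumes po: "partial_order_on {..<d} P" and E: "E \<subseteq> hasse_edges P"
  shows "partial_order_on {..<d} (Id_on {..<d} \<union> E\<^sup>+)"
    and "hasse_edges (Id_on {..<d} \<union> E\<^sup>+) = E"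
    and "poset_of_hasse d E = Id_on {..<d} \<union> E\<^sup>+"
proof -
  let ?Q = "Id_on {..<d} \<union> E\<^sup>+"
  have sub: "P \<subseteq> {..<d} \<times> {..<d}" and rfl: "\<And>x. x < d \<Longrightarrow> (x, x) \<in> P"
    and tr: "trans P" and an: "antisym P"
    using po by (auto simp: partial_order_on_def preorder_on_def refl_on_def)
  have "E \<subseteq> P"
    using E by (auto simp: hasse_edges_def)
  then have EP: "E\<^sup>+ \<subseteq> P"
    using tr trancl_mono_subset[of E P] by (simp add: trancl_id)
  then have QP: "?Q \<subseteq> P"
    using rfl by auto
  have "trans ?Q"
    by (rule transI) (auto intro: trancl_trans)
  moreover have "antisym ?Q"
    using an QP by (meson antisym_subset)
  ultimately show 1: "partial_order_on {..<d} ?Q"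
    using QP sub by (auto simp: partial_order_on_def preorder_on_def refl_on_def)
  have irr: "i \<noteq> j" if "(i, j) \<in> E" for i j
    using that E by (auto simp: hasse_edges_def)
  show 2: "hasse_edges ?Q = E"
  proof (intro equalityI subrelI)
    fix i j assume ij: "(i, j) \<in> hasse_edges ?Q"
    then have "(i, j) \<in> E\<^sup>+"
      by (auto simp: hasse_edges_def)
    then obtain k where k: "(i, k) \<in> E" "(k, j) \<in> E\<^sup>*"
      by (meson tranclD)
    show "(i, j) \<in> E"
    proof (cases "k = j")
      case False
      then have "(k, j) \<in> E\<^sup>+"
        using k by (metis rtranclD)
      with k ij False irr[OF k(1)] show ?thesis
        by (auto simp: hasse_edges_def)
    qed (use k in auto)
  next
    fix i j assume ij: "(i, j) \<in> E"
    then have "(i, j) \<in> hasse_edges P"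
      using E by auto
    with ij QP show "(i, j) \<in> hasse_edges ?Q"
      unfolding hasse_edges_def by auto
  qed
  show "poset_of_hasse d E = ?Q"
    unfolding poset_of_hasse_def
  proof (rule the_equality)
    fix R assume "partial_order_on {..<d} R \<and> hasse_edges R = E"
    then show "R = ?Q"
      using partial_order_on_eq_hasse_closure[of "{..<d}" R] by simp
  qed (use 1 2 in simp)
qed

end

theory Submission
  imports Defs "Jordan_Normal_Form.Determinant"
begin

text \<open>
  In a maximal run of order edges \<open>x\<^sub>a \<ge> \<dots> \<ge> x\<^sub>b\<close> replace each coordinate by its difference to the next
  smaller one and keep the smallest coordinate \<open>x\<^sub>b\<close>. At the top end \<open>a\<close> there are two cases. If no
  chain edge ends in \<open>a\<close>, use \<open>1 - x\<^sub>a\<close> instead of \<open>x\<^sub>a - x\<^bsub>a+1\<^esub>\<close>; the run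
  becomes a chain of its own, since the new coordinates add up to \<open>1 - x\<^sub>a + x\<^bsub>a+1\<^esub>\<close>. If a run of chain
  edges ends in \<open>a\<close>, then \<open>x\<^sub>a\<close> is the sum of the new coordinates of the order run, so its chain
  inequality becomes the one of the concatenated run. Thus the facets become sums over intervals
  overlapping in endpoints, which are the chains of the zigzag \<open>Q\<close> that turns at those endpoints.
  The linear part is a product of a lower and an upper triangular matrix with diagonal entries
  \<open>\<plusminus>1\<close>: the former takes the differences along rising order runs, the latter along falling ones.
\<close>

section \<open>Posets and chains along a path\<close>

text \<open>Edges of the path may be missing, so that the notion covers both halves of an edge
  partition as well as the full Hasse diagram of a zigzag.\<close>

definition path_orientation :: "nat \<Rightarrow> nat rel \<Rightarrow> bool" where
  "path_orientation d E \<longleftrightarrow>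
     (\<forall>(i, j) \<in> E. i < d \<and> j < d \<and> (j = Suc i \<or> i = Suc j)) \<and>
     (\<forall>k. (k, Suc k) \<in> E \<longrightarrow> (Suc k, k) \<notin> E)"

text \<open>Vacuous for \<open>a = b\<close>, like \<open>descending\<close>: a single vertex counts
  as a run.\<close>

definition ascending :: "nat rel \<Rightarrow> nat \<Rightarrow> nat \<Rightarrow> bool" where
  "ascending E a b \<longleftrightarrow> (\<forall>k\<in>{a..<b}. (k, Suc k) \<in> E)"

definition descending :: "nat rel \<Rightarrow> nat \<Rightarrow> nat \<Rightarrow> bool" where
  "descending E a b \<longleftrightarrow> (\<forall>k\<in>{a..<b}. (Suc k, k) \<in> E)"

lemma path_orientationD:
  assumes "path_orientation d E" "(i, j) \<in> E"
  shows "i < d" "j < d" "j = Suc i \<or> i = Suc j" "(j, i) \<notin> E"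
proof -
  have "i < d \<and> j < d \<and> (j = Suc i \<or> i = Suc j)"
    using assms unfolding path_orientation_def by auto
  then show "i < d" "j < d" "j = Suc i \<or> i = Suc j" by auto
  have "(k, Suc k) \<in> E \<Longrightarrow> (Suc k, k) \<notin> E" for k
    using assms(1) unfolding path_orientation_def by simp
  then show "(j, i) \<notin> E"
    using \<open>j = Suc i \<or> i = Suc j\<close> assms(2) by metis
qed

lemma ascending_trancl: "ascending E a b \<Longrightarrow> a < b \<Longrightarrow> (a, b) \<in> E\<^sup>+"
proof (induction b)
  case (Suc b)
  then have e: "(b, Suc b) \<in> E" and "ascending E a b"
    by (auto simp: ascending_def)
  with Suc show ?case
    by (cases "a = b") (auto intro: trancl_into_trancl)
qed simp

lemma descending_trancl: "descending E a b \<Longrightarrow> a < b \<Longrightarrow> (b, a) \<in> E\<^sup>+"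
proof (induction b)
  case (Suc b)
  then have e: "(Suc b, b) \<in> E" and "descending E a b"
    by (auto simp: descending_def)
  with Suc show ?case
    by (cases "a = b") (auto intro: trancl_into_trancl2)
qed simp

text \<open>A directed walk along the path cannot turn back, since its next step would use the edge
  just passed in the opposite direction.\<close>

lemma path_trancl_cases:
  assumes E: "path_orientation d E" and "(i, j) \<in> E\<^sup>+"
  shows "i < j \<and> ascending E i j \<or> j < i \<and> descending E j i"
  using assms(2)
proof (induction rule: trancl_induct)
  case (base j)
  then show ?case
    using path_orientationD[OF E base] by (auto simp: ascending_def descending_def)
next
  case (step j k)
  note jk = path_orientationD[OF E step.hyps(2)]
  show ?case
    using step.IH
  proof
    assume A: "i < j \<and> ascending E i j"
    have "k \<noteq> j - 1"
    proof
      assume "k = j - 1"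
      then have "j = Suc k" "i \<le> k"
        using A by auto
      then have "(k, Suc k) \<in> E" "j = Suc k"
        using A by (auto simp: ascending_def)
      then show False using jk step.hyps(2) by simp
    qed
    then have "k = Suc j" using jk by auto
    then show ?thesis
      using A step.hyps(2) by (auto simp: ascending_def less_Suc_eq)
  next
    assume A: "j < i \<and> descending E j i"
    have "k \<noteq> Suc j"
    proof
      assume "k = Suc j"
      then have "(k, j) \<in> E"
        using A by (auto simp: descending_def)
      then show False using jk step.hyps(2) by simp
    qed
    then have "j = Suc k" using jk by auto
    have "descending E k i"
      unfolding descending_def
    proof
      fix l assume "l \<in> {k..<i}"
      then show "(Suc l, l) \<in> E"
        using A step.hyps(2) \<open>j = Suc k\<close>
        by (cases "l = k") (auto simp: descending_def)
    qed
    with A show ?thesis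
      using \<open>j = Suc k\<close> by simp
  qed
qed

lemma path_trancl_bounds:
  assumes E: "path_orientation d E" and "(i, j) \<in> E\<^sup>+"
  shows "i < d \<and> j < d"
  using assms(2) by (induction rule: trancl_induct) (auto dest: path_orientationD[OF E])

text \<open>As \<open>i\<close> and \<open>j\<close> are neighbours, a detour through
  \<open>k\<close> passes the edge next to \<open>k\<close> in both directions. That edge ends in
  \<open>k\<close> if \<open>k\<close> lies to the right of \<open>i\<close> and starts in
  \<open>k\<close> otherwise.\<close>

lemma path_trancl_betweenD:
  assumes E: "path_orientation d E" and ij: "(i, j) \<in> E" and "(i, k) \<in> E\<^sup>+" "(k, j) \<in> E\<^sup>+"
  shows False
proof -
  have 1: "i < k \<and> ascending E i k \<or> k < i \<and> descending E k i"
    and 2: "k < j \<and> ascending E k j \<or> j < k \<and> descending E j k"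
    using path_trancl_cases[OF E] assms(3,4) by blast+
  obtain m where "(m, Suc m) \<in> E" "(Suc m, m) \<in> E"
  proof (cases "i < k")
    case True
    then obtain m where m: "k = Suc m" "i \<le> m" by (cases k) auto
    moreover have "j < k" "descending E j k"
      using 2 True path_orientationD(3)[OF E ij] by auto
    moreover have "ascending E i k" using 1 True by auto
    ultimately show ?thesis
      using that[of m] by (simp add: ascending_def descending_def)
  next
    case False
    then have "k < i" "descending E k i" using 1 by auto
    moreover have "k < j" "ascending E k j"
      using 2 calculation path_orientationD(3)[OF E ij] by auto
    ultimately show ?thesis
      using that[of k] by (simp add: ascending_def descending_def)
  qed
  then show False using path_orientationD[OF E] by blast
qed

text \<open>Used for \<open>Q\<close>, whose edges are not chosen inside a given poset. Antisymmetry
  and the shape of the covers must therefore come from the path structure.\<close>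

lemma path_orientation_poset:
  assumes E: "path_orientation d E"
  shows "partial_order_on {..<d} (Id_on {..<d} \<union> E\<^sup>+)"
    and "hasse_edges (Id_on {..<d} \<union> E\<^sup>+) = E"
proof -
  let ?Q = "Id_on {..<d} \<union> E\<^sup>+"
  have asym: "(j, i) \<notin> E\<^sup>+" if "(i, j) \<in> E\<^sup>+" for i j
  proof
    assume "(j, i) \<in> E\<^sup>+"
    with that have "(i, i) \<in> E\<^sup>+" by (rule trancl_trans)
    then show False using path_trancl_cases[OF E] by blast
  qed
  have "antisym ?Q"
    using asym by (auto simp: antisym_def)
  moreover have "trans ?Q"
    by (rule transI) (auto intro: trancl_trans)
  moreover have "?Q \<subseteq> {..<d} \<times> {..<d}"
    using path_trancl_bounds[OF E] by auto
  ultimately show "partial_order_on {..<d} ?Q"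
    by (auto simp: partial_order_on_def preorder_on_def refl_on_def)
  show "hasse_edges ?Q = E"
  proof (intro equalityI subrelI)
    fix i j assume ij: "(i, j) \<in> hasse_edges ?Q"
    then have "(i, j) \<in> E\<^sup>+"
      by (auto simp: hasse_edges_def)
    then obtain k where k: "(i, k) \<in> E" "(k, j) \<in> E\<^sup>*"
      by (meson tranclD)
    show "(i, j) \<in> E"
    proof (cases "k = j")
      case False
      then have "(k, j) \<in> E\<^sup>+"
        using k by (metis rtranclD)
      moreover have "i \<noteq> k" using path_orientationD[OF E k(1)] by auto
      ultimately show ?thesis
        using k ij False by (auto simp: hasse_edges_def)
    qed (use k in auto)
  next
    fix i j assume ij: "(i, j) \<in> E"
    then have "i \<noteq> j" using path_orientationD[OF E] by blast
    with ij show "(i, j) \<in> hasse_edges ?Q"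
      using path_trancl_betweenD[OF E ij] by (auto simp: hasse_edges_def)
  qed
qed

section \<open>Chain polytopes of path posets\<close>

lemma chain_extends_to_maxchain:
  assumes "finite A" "pred_on.chain A R C"
  obtains M where "pred_on.maxchain A R M" "C \<subseteq> M"
proof -
  let ?S = "{D. pred_on.chain A R D \<and> C \<subseteq> D}"
  have "finite ?S"
    by (rule finite_subset[of _ "Pow A"]) (use assms(1) in \<open>auto simp: pred_on.chain_def\<close>)
  moreover have "C \<in> ?S" using assms by simp
  ultimately obtain M where M: "M \<in> ?S" "C \<subseteq> M" "\<forall>D\<in>?S. M \<subseteq> D \<longrightarrow> M = D"
    using finite_has_maximal2[of ?S C] by auto
  then have "pred_on.maxchain A R M"
    unfolding pred_on.maxchain_def by blast
  with M that show ?thesis by blast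
qed

text \<open>For nonnegative coordinates, maximal chains and monotone intervals give the same bounds:
  an interval extends to a maximal chain, and a chain lies in the interval from its least to its
  greatest index, which is monotone because these two are comparable.\<close>

lemma chain_polytope_path:
  assumes E: "path_orientation d E"
  shows "chain_polytope d (Id_on {..<d} \<union> E\<^sup>+) =
     {x \<in> carrier_vec d. (\<forall>i<d. 0 \<le> x $ i) \<and>
        (\<forall>a b. a \<le> b \<longrightarrow> b < d \<longrightarrow> ascending E a b \<or> descending E a b \<longrightarrow> (\<Sum>i=a..b. x $ i) \<le> 1)}"
    (is "?L = ?R")
proof (intro equalityI subsetI)
  fix x assume x: "x \<in> ?L"
  have "(\<Sum>i=a..b. x $ i) \<le> 1"
    if ab: "a \<le> b" "b < d" "ascending E a b \<or> descending E a b" for a b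
  proof -
    have "(i, j) \<in> E\<^sup>+ \<or> (j, i) \<in> E\<^sup>+" if "i \<in> {a..b}" "j \<in> {a..b}" "i < j" for i j
    proof -
      have "ascending E i j \<or> descending E i j"
        using ab that by (auto simp: ascending_def descending_def)
      then show ?thesis
        using that ascending_trancl descending_trancl by blast
    qed
    then have "pred_on.chain {..<d} (\<lambda>i j. (i, j) \<in> Id_on {..<d} \<union> E\<^sup>+) {a..b}"
      unfolding pred_on.chain_def using ab
      by (auto; metis (no_types) linorder_neqE_nat atLeastAtMost_iff)
    then obtain M where
      M: "pred_on.maxchain {..<d} (\<lambda>i j. (i, j) \<in> Id_on {..<d} \<union> E\<^sup>+) M" "{a..b} \<subseteq> M"
      using chain_extends_to_maxchain[of "{..<d}"] by blast
    then have "M \<subseteq> {..<d}" by (simp add: pred_on.maxchain_def pred_on.chain_def)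
    then have "(\<Sum>i=a..b. x $ i) \<le> (\<Sum>i\<in>M. x $ i)"
      using x M by (intro sum_mono2) (auto simp: chain_polytope_def intro: finite_subset)
    also have "\<dots> \<le> 1" using x M by (simp add: chain_polytope_def)
    finally show ?thesis .
  qed
  then show "x \<in> ?R" using x by (simp add: chain_polytope_def)
next
  fix x assume x: "x \<in> ?R"
  have "(\<Sum>i\<in>C. x $ i) \<le> 1"
    if "pred_on.maxchain {..<d} (\<lambda>i j. (i, j) \<in> Id_on {..<d} \<union> E\<^sup>+) C" for C
  proof (cases "C = {}")
    case False
    have C: "C \<subseteq> {..<d}"
      and ch: "\<And>i j. i \<in> C \<Longrightarrow> j \<in> C \<Longrightarrow> i \<noteq> j \<Longrightarrow> (i, j) \<in> E\<^sup>+ \<or> (j, i) \<in> E\<^sup>+"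
      using that by (auto simp: pred_on.maxchain_def pred_on.chain_def)
    have fin: "finite C" using C finite_subset by blast
    define a b where "a = Min C" and "b = Max C"
    have ab: "a \<in> C" "b \<in> C" "a \<le> b" "C \<subseteq> {a..b}"
      using fin False by (auto simp: a_def b_def)
    have "ascending E a b \<or> descending E a b"
    proof (cases "a = b")
      case False
      then show ?thesis
        using ch[OF ab(1,2)] path_trancl_cases[OF E] ab(3) by (meson not_le)
    qed (simp add: ascending_def)
    then have "(\<Sum>i=a..b. x $ i) \<le> 1" using x ab C by auto
    moreover have "(\<Sum>i\<in>C. x $ i) \<le> (\<Sum>i=a..b. x $ i)"
      using x ab C by (intro sum_mono2) auto
    ultimately show ?thesis by simp
  qed simp
  then show "x \<in> ?L" using x by (simp add: chain_polytope_def)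
qed

section \<open>The inequalities in the new coordinates\<close>

text \<open>
  \<open>e k\<close> labels the edge joining \<open>k - 1\<close> and \<open>k\<close>, so the edges at the vertex \<open>j\<close> carry \<open>e j\<close> and
  \<open>e (Suc j)\<close>. An order edge is \<open>Falling\<close> if it forces the coordinates to decrease from left to
  right, i.e. if \<open>k - 1 \<prec> k\<close>.
\<close>

datatype edge_label = Absent | Falling | Rising | ChainUp | ChainDown

text \<open>The dummy label at both ends lets the endpoints of the path be treated like inner
  vertices.\<close>

definition labelling :: "nat \<Rightarrow> (nat \<Rightarrow> edge_label) \<Rightarrow> bool" where
  "labelling d e \<longleftrightarrow> (\<forall>k. e k = Absent \<longleftrightarrow> k = 0 \<or> d \<le> k)"

text \<open>
  The labels \<open>p\<close>, \<open>q\<close> of the edges to the left and right of a vertex that is not a turning point of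
  the target zigzag \<open>Q\<close>.
\<close>

definition straight :: "edge_label \<Rightarrow> edge_label \<Rightarrow> bool" where
  "straight p q \<longleftrightarrow> p = q \<or> p \<in> {ChainUp, ChainDown} \<and> q = Falling \<or>
     p = Rising \<and> q \<in> {ChainUp, ChainDown}"

text \<open>Top vertices met by no chain edge; the ends of the path may qualify.\<close>

definition crest :: "(nat \<Rightarrow> edge_label) \<Rightarrow> nat \<Rightarrow> bool" where
  "crest e j \<longleftrightarrow> e j \<in> {Rising, Absent} \<and> e (Suc j) \<in> {Falling, Absent}"

definition falls :: "(nat \<Rightarrow> edge_label) \<Rightarrow> nat \<Rightarrow> bool" where
  "falls e j \<longleftrightarrow> e j \<notin> {Rising, Absent} \<and> e (Suc j) = Falling"

definition rises :: "(nat \<Rightarrow> edge_label) \<Rightarrow> nat \<Rightarrow> bool" where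
  "rises e j \<longleftrightarrow> e j = Rising \<and> e (Suc j) \<notin> {Falling, Absent}"

text \<open>Under a labelling, \<open>rises e j\<close> forces \<open>0 < j\<close>, so
  \<open>j - 1\<close> is not truncated. Unchanged coordinates sit at vertices without a smaller
  neighbour along an order edge.\<close>

definition transfer_map :: "(nat \<Rightarrow> edge_label) \<Rightarrow> (nat \<Rightarrow> real) \<Rightarrow> nat \<Rightarrow> real" where
  "transfer_map e x j =
     (if crest e j then 1 - x j
      else if falls e j then x j - x (Suc j)
      else if rises e j then x j - x (j - 1)
      else x j)"

definition chain_run :: "(nat \<Rightarrow> edge_label) \<Rightarrow> nat \<Rightarrow> nat \<Rightarrow> bool" where
  "chain_run e a b \<longleftrightarrow> (\<exists>c\<in>{ChainUp, ChainDown}. \<forall>k\<in>{a<..b}. e k = c)"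

definition order_chain_ineqs :: "nat \<Rightarrow> (nat \<Rightarrow> edge_label) \<Rightarrow> (nat \<Rightarrow> real) \<Rightarrow> bool" where
  "order_chain_ineqs d e x \<longleftrightarrow>
     (\<forall>i<d. 0 \<le> x i \<and> x i \<le> 1) \<and>
     (\<forall>k. e (Suc k) = Falling \<longrightarrow> x (Suc k) \<le> x k) \<and>
     (\<forall>k. e (Suc k) = Rising \<longrightarrow> x k \<le> x (Suc k)) \<and>
     (\<forall>a b. a \<le> b \<longrightarrow> b < d \<longrightarrow> chain_run e a b \<longrightarrow> sum x {a..b} \<le> 1)"

text \<open>Only inner vertices have to be straight: a chain of \<open>Q\<close> may begin and end
  in turning points.\<close>

definition straight_run_ineqs :: "nat \<Rightarrow> (nat \<Rightarrow> edge_label) \<Rightarrow> (nat \<Rightarrow> real) \<Rightarrow> bool" where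
  "straight_run_ineqs d e y \<longleftrightarrow>
     (\<forall>i<d. 0 \<le> y i) \<and>
     (\<forall>a b. a \<le> b \<longrightarrow> b < d \<longrightarrow> (\<forall>k\<in>{a<..<b}. straight (e k) (e (Suc k))) \<longrightarrow>
        sum y {a..b} \<le> 1)"

section \<open>From the order-chain inequalities to the run inequalities\<close>

lemma chain_run_single: "e (Suc j) \<in> {ChainUp, ChainDown} \<Longrightarrow> chain_run e j (Suc j)"
  by (simp add: chain_run_def flip: atLeastSucAtMost_greaterThanAtMost)

lemma chain_run_Suc:
  assumes "chain_run e c j" "c < j" "e (Suc j) = e j"
  shows "chain_run e c (Suc j)"
proof -
  obtain l where l: "l \<in> {ChainUp, ChainDown}" "\<forall>k\<in>{c<..j}. e k = l"
    using assms(1) by (auto simp: chain_run_def)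
  have "\<forall>k\<in>{c<..Suc j}. e k = l"
    using l(2) assms(2,3) by (auto simp: le_Suc_eq)
  with l(1) show ?thesis by (auto simp: chain_run_def)
qed

lemmas transfer_simps = transfer_map_def crest_def falls_def rises_def

lemma labellingD: "labelling d e \<Longrightarrow> e k \<noteq> Absent \<Longrightarrow> 0 < k \<and> k < d"
  by (metis labelling_def not_gr0 not_le)

text \<open>Invariant for sweeping a straight run from left to right. By \<open>straight\<close>,
  labels can only pass from \<open>Rising\<close> to one chain label and then to
  \<open>Falling\<close>. The sum telescopes on the rising part, is dominated by a chain sum on the
  chain part, and on the falling part leaves room for the next coordinate below 1. Only inequalities
  hold, as \<open>a\<close> may lie in the middle of an order run.\<close>

lemma straight_run_prefix_bound:
  assumes x: "order_chain_ineqs d e x" and e: "labelling d e"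
    and "a \<le> j" "Suc j < d" "\<forall>k\<in>{a<..j}. straight (e k) (e (Suc k))"
  shows "e (Suc j) = Rising \<longrightarrow> sum (transfer_map e x) {a..j} \<le> x j"
    and "e (Suc j) \<in> {ChainUp, ChainDown} \<longrightarrow>
      (\<exists>c\<le>j. chain_run e c (Suc j) \<and> sum (transfer_map e x) {a..j} \<le> sum x {c..j})"
    and "e (Suc j) = Falling \<longrightarrow> sum (transfer_map e x) {a..j} + x (Suc j) \<le> 1"
proof -
  let ?S = "\<lambda>j. sum (transfer_map e x) {a..j}"
  let ?P = "\<lambda>j. (e (Suc j) = Rising \<longrightarrow> ?S j \<le> x j) \<and>
    (e (Suc j) \<in> {ChainUp, ChainDown} \<longrightarrow>
      (\<exists>c\<le>j. chain_run e c (Suc j) \<and> ?S j \<le> sum x {c..j})) \<and>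
    (e (Suc j) = Falling \<longrightarrow> ?S j + x (Suc j) \<le> 1)"
  have bnd: "0 \<le> x i" "x i \<le> 1" if "i < d" for i
    using x that by (auto simp: order_chain_ineqs_def)
  have fal: "x (Suc k) \<le> x k" if "e (Suc k) = Falling" for k
    using x that by (auto simp: order_chain_ineqs_def)
  have chn: "sum x {c..b} \<le> 1"
    if "c \<le> b" "b < d" "chain_run e c b" for c b
    using x that unfolding order_chain_ineqs_def by blast
  have "?P j"
    using assms(3-5)
  proof (induction j rule: dec_induct)
    case base
    have a: "0 \<le> x a" "x a \<le> 1" "0 \<le> x (a - 1)" "0 \<le> x (Suc a)"
      using bnd base by auto
    have "?S a \<le> x a" if "\<not> crest e a"
      using that a by (simp add: transfer_map_def)
    moreover have "?S a + x (Suc a) \<le> 1" if "e (Suc a) = Falling"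
      using that a fal[OF that] by (auto simp: transfer_simps)
    ultimately have "\<exists>c\<le>a. chain_run e c (Suc a) \<and> ?S a \<le> sum x {c..a}"
      if "e (Suc a) \<in> {ChainUp, ChainDown}"
      using that chain_run_single[of e a] by (intro exI[of _ a]) (auto simp: crest_def)
    moreover have "?S a \<le> x a" if "e (Suc a) = Rising"
      using that \<open>\<not> crest e a \<Longrightarrow> ?S a \<le> x a\<close> by (simp add: crest_def)
    ultimately show ?case
      using \<open>e (Suc a) = Falling \<Longrightarrow> ?S a + x (Suc a) \<le> 1\<close> by blast
  next
    case (step j)
    then have IH: "?P j" and st: "straight (e (Suc j)) (e (Suc (Suc j)))" and "a \<le> Suc j"
      by auto
    then have S: "?S (Suc j) = ?S j + transfer_map e x (Suc j)"
      by (simp add: sum.atLeast_Suc_atMost add.commute)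
    consider "e (Suc (Suc j)) = Rising" "e (Suc j) = Rising"
      | "e (Suc (Suc j)) \<in> {ChainUp, ChainDown}" "e (Suc j) = e (Suc (Suc j))"
      | "e (Suc (Suc j)) \<in> {ChainUp, ChainDown}" "e (Suc j) = Rising"
      | "e (Suc (Suc j)) = Falling" "e (Suc j) = Falling"
      | "e (Suc (Suc j)) = Falling" "e (Suc j) \<in> {ChainUp, ChainDown}"
      | "e (Suc (Suc j)) = Absent"
      using st by (cases "e (Suc (Suc j))") (auto simp: straight_def)
    then show ?case
    proof cases
      case 1
      then show ?thesis using IH S by (simp add: transfer_simps)
    next
      case 2
      then obtain c where c: "c \<le> j" "chain_run e c (Suc j)" "?S j \<le> sum x {c..j}"
        using IH by auto
      have "chain_run e c (Suc (Suc j))"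
        using c 2 by (intro chain_run_Suc[of e c "Suc j"]) auto
      moreover have "transfer_map e x (Suc j) = x (Suc j)"
        using 2 by (auto simp: transfer_simps)
      ultimately show ?thesis
        using 2 c S by (auto intro!: exI[of _ c])
    next
      case 3
      \<comment> \<open>The rising part collapses to its top coordinate \<open>x (Suc j)\<close>,
        where a new chain run starts.\<close>
      then have "?S (Suc j) \<le> x (Suc j)"
        using IH S by (auto simp: transfer_simps)
      moreover have "chain_run e (Suc j) (Suc (Suc j))"
        using 3 by (intro chain_run_single)
      ultimately show ?thesis
        using 3 by (auto intro!: exI[of _ "Suc j"])
    next
      case 4
      then show ?thesis using IH S by (simp add: transfer_simps)
    next
      case 5
      then obtain c where c: "c \<le> j" "chain_run e c (Suc j)" "?S j \<le> sum x {c..j}"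
        using IH by auto
      \<comment> \<open>The chain inequality enters where the chain run ends and the falling part
        begins.\<close>
      have "sum x {c..Suc j} \<le> 1"
        using c step.prems 5 by (intro chn) auto
      moreover have "transfer_map e x (Suc j) = x (Suc j) - x (Suc (Suc j))"
        using 5 by (auto simp: transfer_simps)
      ultimately show ?thesis
        using 5 c S by auto
    next
      case 6
      then show ?thesis using step.prems e by (auto simp: labelling_def)
    qed
  qed
  then show "e (Suc j) = Rising \<longrightarrow> ?S j \<le> x j"
    and "e (Suc j) \<in> {ChainUp, ChainDown} \<longrightarrow>
      (\<exists>c\<le>j. chain_run e c (Suc j) \<and> ?S j \<le> sum x {c..j})"
    and "e (Suc j) = Falling \<longrightarrow> ?S j + x (Suc j) \<le> 1"
    by blast+
qed

text \<open>The prefix bound covers all but the last vertex \<open>b\<close>. That one is added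
  separately because it may be a turning point, so its right edge is unrelated to the run.\<close>

lemma straight_run_ineqs_transfer_map:
  assumes x: "order_chain_ineqs d e x" and e: "labelling d e"
  shows "straight_run_ineqs d e (transfer_map e x)"
proof -
  let ?y = "transfer_map e x"
  have bnd: "0 \<le> x i" "x i \<le> 1" if "i < d" for i
    using x that by (auto simp: order_chain_ineqs_def)
  have fal: "x (Suc k) \<le> x k" if "e (Suc k) = Falling" for k
    using x that by (auto simp: order_chain_ineqs_def)
  have ris: "x k \<le> x (Suc k)" if "e (Suc k) = Rising" for k
    using x that by (auto simp: order_chain_ineqs_def)
  have nonneg: "0 \<le> ?y i" if "i < d" for i
    using bnd[OF that] fal[of i] ris[of "i - 1"] labellingD[OF e, of i]
    by (auto simp: transfer_simps)
  have le1: "?y i \<le> 1" if "i < d" for i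
    using bnd[OF that] bnd[of "Suc i"] bnd[OF less_imp_diff_less[OF that, of 1]]
      labellingD[OF e, of "Suc i"]
    by (auto simp: transfer_simps)
  have "sum ?y {a..b} \<le> 1"
    if ab: "a \<le> b" "b < d" "\<forall>k\<in>{a<..<b}. straight (e k) (e (Suc k))" for a b
  proof (cases "a = b")
    case False
    then obtain j where j: "b = Suc j" "a \<le> j" using ab by (cases b) auto
    then have S: "sum ?y {a..b} = sum ?y {a..j} + ?y b"
      using ab by simp
    have pre: "e b = Rising \<longrightarrow> sum ?y {a..j} \<le> x j"
      "e b \<in> {ChainUp, ChainDown} \<longrightarrow>
        (\<exists>c\<le>j. chain_run e c b \<and> sum ?y {a..j} \<le> sum x {c..j})"
      "e b = Falling \<longrightarrow> sum ?y {a..j} + x b \<le> 1"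
      using straight_run_prefix_bound[OF x e j(2)] ab j by auto
    have yb: "?y b \<le> x b" if "e b \<noteq> Rising" "e b \<noteq> Absent"
      using that bnd[of "Suc b"] labellingD[OF e, of "Suc b"]
      by (auto simp: transfer_simps)
    consider "e b = Rising" | "e b = Falling" | "e b \<in> {ChainUp, ChainDown}" | "e b = Absent"
      by (cases "e b") auto
    then show ?thesis
    proof cases
      case 1
      \<comment> \<open>At a crest the sum is at most \<open>x j + 1 - x b\<close>, and
        \<open>x j \<le> x b\<close>; otherwise it telescopes to at most \<open>x b\<close>.\<close>
      then have "?y b = 1 - x b \<or> ?y b = x b - x j"
        using j by (auto simp: transfer_simps)
      then show ?thesis
        using S pre(1) 1 bnd[of b] ris[of j] ab j by auto
    next
      case 2
      then show ?thesis using S pre(3) yb by auto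
    next
      case 3
      then obtain c where c: "c \<le> j" "chain_run e c b" "sum ?y {a..j} \<le> sum x {c..j}"
        using pre(2) by blast
      have "c \<le> b" using c j by simp
      then have "sum x {c..b} \<le> 1"
        using x c(2) ab(2) unfolding order_chain_ineqs_def by blast
      then show ?thesis using S c j yb 3 by auto
    next
      case 4
      then show ?thesis using e ab j by (auto simp: labelling_def)
    qed
  qed (use le1 ab in simp)
  then show ?thesis
    using nonneg unfolding straight_run_ineqs_def by blast
qed

section \<open>Recovering the old coordinates\<close>

text \<open>Telescoping down to the bottom of the falling run, whose coordinate is unchanged. The
  condition on \<open>e j\<close> persists, as every later vertex of the run has
  \<open>Falling\<close> on its left.\<close>

lemma coordinate_as_falling_sum:
  assumes e: "labelling d e" and "j < d" "e j \<notin> {Rising, Absent}"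
  shows "\<exists>b\<ge>j. b < d \<and> (\<forall>k\<in>{j<..b}. e k = Falling) \<and> x j = sum (transfer_map e x) {j..b}"
  using assms(2,3)
proof (induction "d - j" arbitrary: j)
  case (Suc n)
  show ?case
  proof (cases "e (Suc j) = Falling")
    case True
    then have "Suc j < d" using labellingD[OF e, of "Suc j"] by simp
    moreover have "n = d - Suc j" using Suc.hyps(2) by simp
    ultimately obtain b where b: "Suc j \<le> b" "b < d" "\<forall>k\<in>{Suc j<..b}. e k = Falling"
      "x (Suc j) = sum (transfer_map e x) {Suc j..b}"
      using Suc.hyps(1)[of "Suc j"] True by auto
    have "\<forall>k\<in>{j<..b}. e k = Falling"
      using b True by (metis Suc_lessI greaterThanAtMost_iff)
    moreover have "transfer_map e x j = x j - x (Suc j)"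
      using True Suc.prems by (simp add: transfer_simps)
    ultimately show ?thesis
      using b by (auto simp: sum.atLeast_Suc_atMost intro!: exI[of _ b])
  next
    case False
    then show ?thesis using Suc.prems
      by (auto simp: transfer_simps intro!: exI[of _ j])
  qed
qed simp

text \<open>Mirror image of the falling case: the run goes to the left, so the induction is on
  \<open>j\<close> itself.\<close>

lemma coordinate_as_rising_sum:
  assumes e: "labelling d e" and "e (Suc j) \<notin> {Falling, Absent}"
  shows "\<exists>a\<le>j. (\<forall>k\<in>{a<..j}. e k = Rising) \<and> x j = sum (transfer_map e x) {a..j}"
  using assms(2)
proof (induction j)
  case 0
  have "e 0 = Absent" using e by (simp add: labelling_def)
  then show ?case using 0 by (auto simp: transfer_simps)
next
  case (Suc j)
  show ?case
  proof (cases "e (Suc j) = Rising")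
    case True
    then obtain a where a: "a \<le> j" "\<forall>k\<in>{a<..j}. e k = Rising"
      "x j = sum (transfer_map e x) {a..j}"
      using Suc.IH by auto
    have "\<forall>k\<in>{a<..Suc j}. e k = Rising"
      using a True by (metis greaterThanAtMost_iff le_SucE)
    moreover have "transfer_map e x (Suc j) = x (Suc j) - x j"
      using True Suc.prems by (simp add: transfer_simps)
    ultimately show ?thesis
      using a by (auto intro!: exI[of _ a])
  next
    case False
    then show ?thesis using Suc.prems
      by (auto simp: transfer_simps intro!: exI[of _ "Suc j"])
  qed
qed

text \<open>Off the crests each old coordinate is a sum of new ones over a straight run. Every
  inequality for \<open>x\<close> thus follows from nonnegativity of new coordinates or from a bound
  on one straight run.\<close>

lemma order_chain_ineqs_if_transfer_map:
  assumes y: "straight_run_ineqs d e (transfer_map e x)" and e: "labelling d e"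
  shows "order_chain_ineqs d e x"
proof -
  let ?y = "transfer_map e x"
  have nonneg: "0 \<le> ?y i" if "i < d" for i
    using y that by (auto simp: straight_run_ineqs_def)
  have run: "sum ?y {a..b} \<le> 1"
    if "a \<le> b" "b < d" "\<And>k. a < k \<Longrightarrow> k < b \<Longrightarrow> straight (e k) (e (Suc k))" for a b
    using y that unfolding straight_run_ineqs_def by (meson greaterThanLessThan_iff)
  have bnd: "0 \<le> x j \<and> x j \<le> 1" if j: "j < d" for j
  proof -
    consider "e j \<notin> {Rising, Absent}" | "e (Suc j) \<notin> {Falling, Absent}" | "crest e j"
      by (auto simp: crest_def)
    then show ?thesis
    proof cases
      case 1
      then obtain b where b: "j \<le> b" "b < d" "\<forall>k\<in>{j<..b}. e k = Falling" "x j = sum ?y {j..b}"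
        using coordinate_as_falling_sum[OF e j] by blast
      then have "sum ?y {j..b} \<le> 1" by (intro run) (auto simp: straight_def)
      moreover have "0 \<le> sum ?y {j..b}" using b nonneg by (intro sum_nonneg) auto
      ultimately show ?thesis using b by simp
    next
      case 2
      then obtain a where a: "a \<le> j" "\<forall>k\<in>{a<..j}. e k = Rising" "x j = sum ?y {a..j}"
        using coordinate_as_rising_sum[OF e] by blast
      then have "sum ?y {a..j} \<le> 1" using j by (intro run) (auto simp: straight_def)
      moreover have "0 \<le> sum ?y {a..j}" using j nonneg by (intro sum_nonneg) auto
      ultimately show ?thesis using a by simp
    next
      case 3
      have "sum ?y {j..j} \<le> 1" using j by (intro run) auto
      with 3 show ?thesis using nonneg[OF j] by (simp add: transfer_map_def)
    qed
  qed
  moreover have "x (Suc k) \<le> x k" if k: "e (Suc k) = Falling" for k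
  proof (cases "crest e k")
    case True
    have kd: "Suc k < d" using labellingD[OF e, of "Suc k"] k by simp
    then obtain b where b: "Suc k \<le> b" "b < d" "\<forall>i\<in>{Suc k<..b}. e i = Falling"
      "x (Suc k) = sum ?y {Suc k..b}"
      using coordinate_as_falling_sum[OF e kd, of x] k by auto
    have fal: "e i = Falling" if "k < i" "i \<le> b" for i
      using that b(3) k by (metis Suc_lessI greaterThanAtMost_iff)
    \<comment> \<open>The run starting at the crest \<open>k\<close> has sum
      \<open>1 - x k + x (Suc k)\<close>, so its bound is the order inequality.\<close>
    have "sum ?y {k..b} \<le> 1"
      using b fal by (intro run) (auto simp: straight_def)
    moreover have "sum ?y {k..b} = ?y k + x (Suc k)"
      using b by (simp add: sum.atLeast_Suc_atMost)
    ultimately show ?thesis using True by (simp add: transfer_map_def)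
  next
    case False
    with k have "?y k = x k - x (Suc k)" by (auto simp: transfer_simps)
    then show ?thesis using nonneg[of k] labellingD[OF e, of "Suc k"] k by simp
  qed
  moreover have "x k \<le> x (Suc k)" if k: "e (Suc k) = Rising" for k
  proof (cases "crest e (Suc k)")
    case True
    have kd: "Suc k < d" using labellingD[OF e, of "Suc k"] k by simp
    obtain a where a: "a \<le> k" "\<forall>i\<in>{a<..k}. e i = Rising" "x k = sum ?y {a..k}"
      using coordinate_as_rising_sum[OF e, of k x] k by auto
    have ris: "e i = Rising" if "a < i" "i \<le> Suc k" for i
      using that a(2) k by (metis le_SucE greaterThanAtMost_iff)
    have "sum ?y {a..Suc k} \<le> 1"
      using a ris kd by (intro run) (auto simp: straight_def)
    then show ?thesis using True a by (simp add: transfer_map_def)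
  next
    case False
    with k have "?y (Suc k) = x (Suc k) - x k" by (auto simp: transfer_simps)
    then show ?thesis using nonneg[of "Suc k"] labellingD[OF e, of "Suc k"] k by simp
  qed
  moreover have "sum x {a..b} \<le> 1"
    if ab: "a \<le> b" "b < d" and r: "chain_run e a b" for a b
  proof (cases "a = b")
    case False
    obtain c where c: "c \<in> {ChainUp, ChainDown}" and lab: "\<forall>k\<in>{a<..b}. e k = c"
      using r unfolding chain_run_def by blast
    note ab = ab lab
    from False ab have "a < b" by simp
    then have ea: "e (Suc a) = c" and eb: "e b = c" using ab by auto
    \<comment> \<open>The chain run is prolonged by the rising run below \<open>x a\<close> and the
      falling run below \<open>x b\<close>; the coordinates strictly between \<open>a\<close> and
      \<open>b\<close> are unchanged.\<close>
    obtain a' where a': "a' \<le> a" "\<forall>k\<in>{a'<..a}. e k = Rising" "x a = sum ?y {a'..a}"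
      using coordinate_as_rising_sum[OF e, of a x] ea c by auto
    obtain b' where b': "b \<le> b'" "b' < d" "\<forall>k\<in>{b<..b'}. e k = Falling" "x b = sum ?y {b..b'}"
      using coordinate_as_falling_sum[OF e ab(2), of x] eb c by auto
    have mid: "sum ?y {Suc a..<b} = sum x {Suc a..<b}"
    proof (rule sum.cong)
      fix k assume "k \<in> {Suc a..<b}"
      then have "e k = c" "e (Suc k) = c" using ab by auto
      then show "?y k = x k" using c by (auto simp: transfer_simps)
    qed simp
    have split: "sum f {p..q} = sum f {p..a} + sum f {Suc a..<b} + sum f {b..q}"
      if "p \<le> a" "b \<le> q" for p q and f :: "nat \<Rightarrow> real"
    proof -
      have "{p..q} = ({p..a} \<union> {Suc a..<b}) \<union> {b..q}" using that \<open>a < b\<close> by auto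
      also have "sum f \<dots> = sum f ({p..a} \<union> {Suc a..<b}) + sum f {b..q}"
        using \<open>a < b\<close> by (intro sum.union_disjoint) auto
      also have "sum f ({p..a} \<union> {Suc a..<b}) = sum f {p..a} + sum f {Suc a..<b}"
        by (intro sum.union_disjoint) auto
      finally show ?thesis .
    qed
    have "sum x {a..b} = sum ?y {a'..b'}"
      using split[of a b x] split[OF a'(1) b'(1), of ?y] a' b' mid by simp
    also have "\<dots> \<le> 1"
    proof (rule run)
      fix k assume k: "a' < k" "k < b'"
      \<comment> \<open>The glued run changes label only from \<open>Rising\<close> to
        \<open>c\<close> and from \<open>c\<close> to \<open>Falling\<close>, both of which are
        straight.\<close>
      have lab: "e k = (if k \<le> a then Rising else if k \<le> b then c else Falling)"
        if "a' < k" "k \<le> b'" for k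
        using that a' b' ab by auto
      show "straight (e k) (e (Suc k))"
        using lab[of k] lab[of "Suc k"] k c \<open>a < b\<close> by (auto simp: straight_def split: if_splits)
    qed (use a' b' ab in auto)
    finally show ?thesis .
  qed (use bnd ab in simp)
  ultimately show ?thesis
    unfolding order_chain_ineqs_def by blast
qed

section \<open>Polytopes of edge partitions and of straightened zigzags\<close>

text \<open>\<open>ChainDown\<close> is a default: for an edge partition of a zigzag, only
  \<open>(k, k - 1) \<in> snd l\<close> is left at that point.\<close>

definition edge_labels :: "nat \<Rightarrow> nat rel \<times> nat rel \<Rightarrow> nat \<Rightarrow> edge_label" where
  "edge_labels d l k =
     (if k = 0 \<or> d \<le> k then Absent
      else if (k - 1, k) \<in> fst l then Falling
      else if (k, k - 1) \<in> fst l then Rising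
      else if (k - 1, k) \<in> snd l then ChainUp
      else ChainDown)"

lemma labelling_edge_labels: "labelling d (edge_labels d l)"
  by (simp add: labelling_def edge_labels_def)

lemma path_orientation_hasse_edges:
  assumes "zigzag_poset d P"
  shows "path_orientation d (hasse_edges P)"
proof -
  have po: "partial_order_on {..<d} P" and h: "\<And>i j. (i, j) \<in> hasse_edges P \<Longrightarrow> j = Suc i \<or> i = Suc j"
    using assms by (auto simp: zigzag_poset_def)
  have sub: "P \<subseteq> {..<d} \<times> {..<d}" and "antisym P"
    using po by (auto simp: partial_order_on_def preorder_on_def refl_on_def)
  moreover have "hasse_edges P \<subseteq> P" by (auto simp: hasse_edges_def)
  moreover have "(k, Suc k) \<in> hasse_edges P \<Longrightarrow> (Suc k, k) \<notin> hasse_edges P" for k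
    using calculation antisymD by (metis n_not_Suc_n subsetD)
  ultimately show ?thesis
    using h unfolding path_orientation_def by blast
qed

lemma edge_labels_iff:
  assumes P: "zigzag_poset d P" and l: "edge_partition P l"
  shows "edge_labels d l (Suc k) = Falling \<longleftrightarrow> (k, Suc k) \<in> fst l"
    and "edge_labels d l (Suc k) = Rising \<longleftrightarrow> (Suc k, k) \<in> fst l"
    and "edge_labels d l (Suc k) = ChainUp \<longleftrightarrow> (k, Suc k) \<in> snd l"
    and "edge_labels d l (Suc k) = ChainDown \<longleftrightarrow> (Suc k, k) \<in> snd l"
proof -
  have un: "fst l \<union> snd l = hasse_edges P" and dis: "fst l \<inter> snd l = {}"
    using l by (auto simp: edge_partition_def)
  note D = path_orientationD[OF path_orientation_hasse_edges[OF P]]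
  have all: "Suc k < d \<Longrightarrow>
    (k, Suc k) \<in> fst l \<union> snd l \<or> (Suc k, k) \<in> fst l \<union> snd l"
    using P un by (auto simp: zigzag_poset_def)
  have bound: "Suc k < d" if "(k, Suc k) \<in> fst l \<union> snd l \<or> (Suc k, k) \<in> fst l \<union> snd l"
    using that D(1,2) un by blast
  have asym: "(k, Suc k) \<in> fst l \<union> snd l \<Longrightarrow> (Suc k, k) \<notin> fst l \<union> snd l"
    using D(4) un by blast
  show "edge_labels d l (Suc k) = Falling \<longleftrightarrow> (k, Suc k) \<in> fst l"
    "edge_labels d l (Suc k) = Rising \<longleftrightarrow> (Suc k, k) \<in> fst l"
    "edge_labels d l (Suc k) = ChainUp \<longleftrightarrow> (k, Suc k) \<in> snd l"
    "edge_labels d l (Suc k) = ChainDown \<longleftrightarrow> (Suc k, k) \<in> snd l"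
    using all bound asym dis by (auto simp: edge_labels_def)
qed

lemma path_orientation_subset:
  assumes E: "path_orientation d E" and F: "F \<subseteq> E"
  shows "path_orientation d F"
proof -
  have "(k, Suc k) \<in> F \<Longrightarrow> (Suc k, k) \<notin> F" for k
    using path_orientationD(4)[OF E] F by (meson subsetD)
  moreover have "i < d \<and> j < d \<and> (j = Suc i \<or> i = Suc j)" if "(i, j) \<in> F" for i j
    using path_orientationD(1-3)[OF E] F that by (meson subsetD)
  ultimately show ?thesis
    unfolding path_orientation_def by (auto simp del: not_less)
qed

lemma order_polytope_trancl:
  assumes E: "path_orientation d E"
  shows "order_polytope d (Id_on {..<d} \<union> E\<^sup>+) =
     {x \<in> carrier_vec d. (\<forall>i<d. 0 \<le> x $ i \<and> x $ i \<le> 1) \<and>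
        (\<forall>k. ((k, Suc k) \<in> E \<longrightarrow> x $ Suc k \<le> x $ k) \<and> ((Suc k, k) \<in> E \<longrightarrow> x $ k \<le> x $ Suc k))}"
    (is "?L = ?R")
proof (intro equalityI subsetI)
  fix x assume x: "x \<in> ?R"
  have edge: "x $ j \<le> x $ i" if "(i, j) \<in> E" for i j
  proof -
    have "((k, Suc k) \<in> E \<longrightarrow> x $ Suc k \<le> x $ k) \<and> ((Suc k, k) \<in> E \<longrightarrow> x $ k \<le> x $ Suc k)" for k
      using x by blast
    then show ?thesis using path_orientationD(3)[OF E that] that by metis
  qed
  have "x $ j \<le> x $ i" if "(i, j) \<in> E\<^sup>+" for i j
    using that by (induction rule: trancl_induct) (auto dest: edge intro: order_trans)
  then show "x \<in> ?L" using x by (auto simp: order_polytope_def)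
next
  fix x assume "x \<in> ?L"
  then have x: "x \<in> carrier_vec d" "\<forall>i<d. 0 \<le> x $ i \<and> x $ i \<le> 1"
    and "\<And>i j. (i, j) \<in> E\<^sup>+ \<Longrightarrow> x $ j \<le> x $ i"
    unfolding order_polytope_def by auto
  then show "x \<in> ?R" by blast
qed

text \<open>Index shift between labels, where \<open>k\<close> is the right end of its edge, and
  \<open>ascending\<close> or \<open>descending\<close>, where \<open>k\<close> is the left
  end.\<close>

lemma ball_Suc_edges: "(\<forall>k\<in>{a<..b}. Q k) \<longleftrightarrow> (\<forall>k\<in>{a..<b}. Q (Suc k))"
  by (auto simp flip: image_Suc_atLeastLessThan atLeastSucAtMost_greaterThanAtMost
      atLeastLessThanSuc_atLeastAtMost)

lemma order_chain_polytope_iff: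
  assumes P: "zigzag_poset d P" and l: "edge_partition P l"
  shows "x \<in> order_chain_polytope d l \<longleftrightarrow>
    x \<in> carrier_vec d \<and> order_chain_ineqs d (edge_labels d l) (\<lambda>i. x $ i)"
proof -
  let ?e = "edge_labels d l"
  have po: "partial_order_on {..<d} P" using P by (simp add: zigzag_poset_def)
  have sub: "fst l \<subseteq> hasse_edges P" "snd l \<subseteq> hasse_edges P"
    using l by (auto simp: edge_partition_def)
  note path = path_orientation_subset[OF path_orientation_hasse_edges[OF P]]
  have run: "chain_run ?e a b \<longleftrightarrow> ascending (snd l) a b \<or> descending (snd l) a b" for a b
    unfolding chain_run_def ball_Suc_edges
    by (simp add: edge_labels_iff[OF P l] ascending_def descending_def)
  show ?thesis
    unfolding order_chain_polytope_def poset_of_hasse_eq(3)[OF po sub(1)]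
      poset_of_hasse_eq(3)[OF po sub(2)] order_polytope_trancl[OF path[OF sub(1)]]
      chain_polytope_path[OF path[OF sub(2)]] order_chain_ineqs_def
      run edge_labels_iff[OF P l]
    by auto
qed

section \<open>The zigzag \<open>Q\<close>\<close>

text \<open>Direction in \<open>Q\<close> of the edge joining \<open>k - 1\<close> and
  \<open>k\<close>; the Boolean equation keeps it at straight vertices and flips it at turning
  points. The value at the dummy index 0 is a free choice: the other one gives the dual poset, which
  has the same chains.\<close>

primrec upward :: "(nat \<Rightarrow> edge_label) \<Rightarrow> nat \<Rightarrow> bool" where
  "upward e 0 = True"
| "upward e (Suc k) = (upward e k = straight (e k) (e (Suc k)))"

definition straightened_edges :: "nat \<Rightarrow> (nat \<Rightarrow> edge_label) \<Rightarrow> nat rel" where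
  "straightened_edges d e =
     {(k, Suc k) | k. Suc k < d \<and> upward e (Suc k)} \<union>
     {(Suc k, k) | k. Suc k < d \<and> \<not> upward e (Suc k)}"

lemma straightened_edges_iff:
  "(k, Suc k) \<in> straightened_edges d e \<longleftrightarrow> Suc k < d \<and> upward e (Suc k)"
  "(Suc k, k) \<in> straightened_edges d e \<longleftrightarrow> Suc k < d \<and> \<not> upward e (Suc k)"
  unfolding straightened_edges_def by auto

lemma path_orientation_straightened_edges: "path_orientation d (straightened_edges d e)"
  unfolding path_orientation_def straightened_edges_def by auto

lemma zigzag_straightened_edges:
  "zigzag_poset d (Id_on {..<d} \<union> (straightened_edges d e)\<^sup>+)"
  unfolding zigzag_poset_def
    path_orientation_poset(2)[OF path_orientation_straightened_edges]
  using path_orientation_poset(1)[OF path_orientation_straightened_edges]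
  by (auto simp: straightened_edges_iff straightened_edges_def)

text \<open>The direction is constant on the edges of the interval iff it flips at no inner
  vertex.\<close>

lemma monotone_straightened_edges_iff:
  assumes "b < d"
  shows "ascending (straightened_edges d e) a b \<or> descending (straightened_edges d e) a b \<longleftrightarrow>
    (\<forall>k\<in>{a<..<b}. straight (e k) (e (Suc k)))"
proof -
  have asc: "ascending (straightened_edges d e) a b \<longleftrightarrow> (\<forall>k\<in>{a<..b}. upward e k)"
    and desc: "descending (straightened_edges d e) a b \<longleftrightarrow> (\<forall>k\<in>{a<..b}. \<not> upward e k)"
    unfolding ball_Suc_edges using assms
    by (auto simp: ascending_def descending_def straightened_edges_iff)
  have step: "upward e (Suc k) = upward e k \<longleftrightarrow> straight (e k) (e (Suc k))" for k
    by auto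
  show ?thesis
  proof
    assume "ascending (straightened_edges d e) a b \<or> descending (straightened_edges d e) a b"
    then show "\<forall>k\<in>{a<..<b}. straight (e k) (e (Suc k))"
      unfolding asc desc step[symmetric] by (auto simp del: upward.simps)
  next
    assume st: "\<forall>k\<in>{a<..<b}. straight (e k) (e (Suc k))"
    have "upward e k = upward e (Suc a)" if "Suc a \<le> k" "k \<le> b" for k
      using that
    proof (induction k rule: dec_induct)
      case (step k)
      then show ?case using st by auto
    qed simp
    then show "ascending (straightened_edges d e) a b \<or> descending (straightened_edges d e) a b"
      unfolding asc desc by (metis Suc_leI greaterThanAtMost_iff)
  qed
qed

lemma chain_polytope_straightened_iff:
  "y \<in> chain_polytope d (Id_on {..<d} \<union> (straightened_edges d e)\<^sup>+) \<longleftrightarrow>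
    y \<in> carrier_vec d \<and> straight_run_ineqs d e (\<lambda>i. y $ i)"
  unfolding chain_polytope_path[OF path_orientation_straightened_edges] straight_run_ineqs_def
  by (auto simp: monotone_straightened_edges_iff)

text \<open>Needed because the entries of the image vector are only known below
  \<open>d\<close>.\<close>

lemma straight_run_ineqs_cong:
  assumes "\<And>i. i < d \<Longrightarrow> y i = z i"
  shows "straight_run_ineqs d e y \<longleftrightarrow> straight_run_ineqs d e z"
proof -
  have "b < d \<Longrightarrow> sum y {a..b} = sum z {a..b}" for a b
    using assms by (intro sum.cong) auto
  then show ?thesis
    using assms unfolding straight_run_ineqs_def by simp
qed

section \<open>Unimodularity\<close>

text \<open>The adjugate divided by the determinant is an inverse over any commutative ring; this
  serves both the integers and the reals.\<close>

lemma invertible_mat_if_det_is_unit: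
  fixes A :: "'a :: comm_ring_1 mat"
  assumes A: "A \<in> carrier_mat n n" and u: "det A dvd 1"
  shows "invertible_mat A"
proof -
  obtain c where c: "det A * c = 1" using u by (metis dvdE)
  let ?B = "c \<cdot>\<^sub>m adj_mat A"
  have "A * ?B = 1\<^sub>m n" "?B * A = 1\<^sub>m n"
    using c by (auto simp: mult_smult_distrib[OF A adj_mat(1)[OF A]]
        mult_smult_assoc_mat[OF adj_mat(1)[OF A] A] adj_mat[OF A] mult.commute)
  then show ?thesis
    using A adj_mat(1)[OF A] unfolding invertible_mat_def inverts_mat_def by auto
qed

lemma unimodularly_equivalentI:
  assumes U: "U \<in> carrier_mat d d" "det U dvd 1" and b: "b \<in> carrier_vec d"
    and A: "A \<subseteq> carrier_vec d" and B: "B \<subseteq> carrier_vec d"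
    and iff: "\<And>x. x \<in> carrier_vec d \<Longrightarrow>
      x \<in> A \<longleftrightarrow> map_mat real_of_int U *\<^sub>v x + map_vec real_of_int b \<in> B"
  shows "unimodularly_equivalent d A B"
proof -
  let ?U = "map_mat real_of_int U" and ?b = "map_vec real_of_int b"
  have inv: "invertible_mat U" using U by (rule invertible_mat_if_det_is_unit)
  \<comment> \<open>The unit determinant survives the embedding, which yields a real inverse for
    constructing preimages.\<close>
  have "det ?U dvd 1"
    using U(2) of_int_hom.hom_det[of U, where 'a = real] by auto
  then obtain V where V: "V \<in> carrier_mat d d" "?U * V = 1\<^sub>m d"
    using invertible_mat_if_det_is_unit[of ?U d] U(1)
    unfolding invertible_mat_def inverts_mat_def
    by (auto simp: dvd_field_iff)
      (metis carrier_matI index_map_mat(2,3) index_mult_mat(2,3) index_one_mat(2,3) carrier_matD)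
  have "(\<lambda>x. ?U *\<^sub>v x + ?b) ` A = B"
  proof (intro equalityI subsetI)
    fix y assume y: "y \<in> B"
    define x where "x = V *\<^sub>v (y - ?b)"
    have x: "x \<in> carrier_vec d" using V y B b by (auto simp: x_def)
    have yb: "y - ?b \<in> carrier_vec d" using y B b by auto
    have "?U *\<^sub>v x = y - ?b"
      unfolding x_def using assoc_mult_mat_vec[OF _ V(1) yb, of ?U d] U(1) V(2) yb by simp
    then have "?U *\<^sub>v x + ?b = y"
      using y B b by (intro eq_vecI) auto
    then show "y \<in> (\<lambda>x. ?U *\<^sub>v x + ?b) ` A" using iff[OF x] y by force
  qed (use iff A in auto)
  then show ?thesis
    unfolding unimodularly_equivalent_def using U(1) b inv by blast
qed

text \<open>Row \<open>i\<close> has a second entry in column \<open>n i\<close>, which drops out if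
  \<open>n i\<close> is outside the matrix, as for \<open>Suc\<close> in the last row.\<close>

definition two_entry_mat :: "nat \<Rightarrow> (nat \<Rightarrow> int) \<Rightarrow> (nat \<Rightarrow> nat) \<Rightarrow> (nat \<Rightarrow> int) \<Rightarrow> int mat" where
  "two_entry_mat d s n t =
     mat d d (\<lambda>(i, j). (if j = i then s i else 0) + (if j = n i then t i else 0))"

lemma two_entry_mat_carrier [simp]: "two_entry_mat d s n t \<in> carrier_mat d d"
  by (simp add: two_entry_mat_def)

lemma two_entry_mat_mult_vec:
  fixes x :: "real vec"
  assumes "x \<in> carrier_vec d" "i < d" "t i \<noteq> 0 \<Longrightarrow> n i < d"
  shows "(map_mat real_of_int (two_entry_mat d s n t) *\<^sub>v x) $ i =
    of_int (s i) * x $ i + of_int (t i) * x $ n i"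
proof -
  have "(map_mat real_of_int (two_entry_mat d s n t) *\<^sub>v x) $ i =
    (\<Sum>j\<in>{0..<d}. of_int ((if j = i then s i else 0) + (if j = n i then t i else 0)) * x $ j)"
    using assms by (auto simp: two_entry_mat_def scalar_prod_def intro!: sum.cong)
  also have "\<dots> = (\<Sum>j\<in>{0..<d}. (if j = i then of_int (s i) * x $ j else 0) +
      (if j = n i then of_int (t i) * x $ j else 0))"
    by (intro sum.cong) (auto simp: algebra_simps)
  also have "\<dots> = of_int (s i) * x $ i + of_int (t i) * x $ n i"
    using assms by (auto simp: sum.distrib)
  finally show ?thesis .
qed

text \<open>The matrix is triangular with diagonal \<open>s\<close>. The condition on fixed points
  of \<open>n\<close> keeps \<open>t\<close> off the diagonal; it matters for \<open>i - 1\<close>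
  at \<open>i = 0\<close>.\<close>

lemma det_two_entry_mat_dvd_1:
  assumes s: "\<And>i. s i dvd 1" and t: "\<And>i. n i = i \<Longrightarrow> t i = 0"
    and tri: "(\<forall>i. n i \<le> i) \<or> (\<forall>i. i \<le> n i)"
  shows "det (two_entry_mat d s n t) dvd 1"
proof -
  let ?M = "two_entry_mat d s n t"
  have "det ?M = prod_list (diag_mat ?M)"
    using tri
  proof
    assume "\<forall>i. n i \<le> i"
    then show ?thesis
      by (intro det_lower_triangular[of d])
        (auto simp: two_entry_mat_def dest: spec[where P = "\<lambda>i. n i \<le> i"] leD)
  next
    assume "\<forall>i. i \<le> n i"
    then show ?thesis
      by (intro det_upper_triangular[of _ d])
        (auto simp: two_entry_mat_def upper_triangular_def dest: leD)
  qed
  also have "diag_mat ?M = map s [0..<d]"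
    using t by (auto simp: diag_mat_def two_entry_mat_def)
  also have "prod_list (map s xs) dvd 1" for xs
    using s by (induction xs) (auto simp: abs_mult)
  finally show ?thesis .
qed

lemma transfer_map_unimodular:
  assumes e: "labelling d e"
  obtains U b where "U \<in> carrier_mat d d" "det U dvd 1" "b \<in> carrier_vec d"
    "\<And>x i. x \<in> carrier_vec d \<Longrightarrow> i < d \<Longrightarrow>
      (map_mat real_of_int U *\<^sub>v x + map_vec real_of_int b) $ i = transfer_map e (\<lambda>i. x $ i) i"
proof -
  \<comment> \<open>\<open>R\<close> is applied first: it takes rising differences and changes signs
    at crests. \<open>F\<close> then takes falling differences.\<close>
  define F where "F = two_entry_mat d (\<lambda>_. 1) Suc (\<lambda>i. if falls e i then - 1 else 0)"
  define R where "R = two_entry_mat d (\<lambda>i. if crest e i then - 1 else 1) (\<lambda>i. i - 1)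
    (\<lambda>i. if rises e i then - 1 else 0)"
  define b where "b = vec d (\<lambda>i. if crest e i then 1 else 0 :: int)"
  have FR: "F \<in> carrier_mat d d" "R \<in> carrier_mat d d"
    by (simp_all add: F_def R_def)
  have "e 0 = Absent" using e by (simp add: labelling_def)
  then have r0: "\<not> rises e 0" by (simp add: rises_def)
  have r1: "\<not> rises e i" if "i - 1 = i" for i
    using r0 that by (cases i) auto
  have "det F dvd 1"
    unfolding F_def by (rule det_two_entry_mat_dvd_1) auto
  moreover have "det R dvd 1"
    unfolding R_def using r1 by (intro det_two_entry_mat_dvd_1) auto
  ultimately have det: "det (F * R) dvd 1"
    using det_mult[OF FR] by (metis mult_1 mult_dvd_mono)
  have "(map_mat real_of_int (F * R) *\<^sub>v x + map_vec real_of_int b) $ i = transfer_map e (\<lambda>i. x $ i) i"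
    if x: "x \<in> carrier_vec d" and i: "i < d" for x i
  proof -
    define z where "z = map_mat real_of_int R *\<^sub>v x"
    have zc: "z \<in> carrier_vec d" unfolding z_def using FR x by auto
    have z: "z $ k = (if crest e k then - 1 else 1) * x $ k + (if rises e k then - 1 else 0) * x $ (k - 1)"
      if "k < d" for k
      unfolding z_def R_def using x that by (subst two_entry_mat_mult_vec) auto
    have f: "Suc i < d" if "falls e i"
      using that labellingD[OF e, of "Suc i"] by (simp add: falls_def)
    have "map_mat real_of_int (F * R) *\<^sub>v x = map_mat real_of_int F *\<^sub>v z"
      unfolding z_def of_int_hom.mat_hom_mult[OF FR] using FR x by (intro assoc_mult_mat_vec) auto
    then have "(map_mat real_of_int (F * R) *\<^sub>v x) $ i =
        z $ i + (if falls e i then - 1 else 0) * z $ Suc i"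
      using two_entry_mat_mult_vec[OF zc i, of "\<lambda>i. if falls e i then - 1 else 0" Suc "\<lambda>_. 1"] f
      by (cases "falls e i") (simp_all add: F_def)
    \<comment> \<open>The factors do not interfere: the edge left of \<open>Suc i\<close> is
      \<open>Falling\<close>, so \<open>R\<close> leaves this coordinate alone.\<close>
    moreover have "z $ Suc i = x $ Suc i" if "falls e i"
      using z[OF f[OF that]] that by (auto simp: falls_def crest_def rises_def)
    moreover have "dim_vec b = d" "b $ i = (if crest e i then 1 else 0)"
      using i by (simp_all add: b_def)
    ultimately show ?thesis
      using z[OF i] i by (auto simp: transfer_simps)
  qed
  then show ?thesis
    using FR det by (intro that[of "F * R" b]) (auto simp: b_def)
qed

theorem theorem3p4:
  fixes d :: nat and P :: "nat rel"
  assumes "zigzag_poset d P"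
  shows "\<forall>l. edge_partition P l \<longrightarrow>
           (\<exists>Q. zigzag_poset d Q \<and>
                unimodularly_equivalent d (order_chain_polytope d l) (chain_polytope d Q))"
proof (intro allI impI)
  fix l assume l: "edge_partition P l"
  let ?e = "edge_labels d l"
  let ?Q = "Id_on {..<d} \<union> (straightened_edges d ?e)\<^sup>+"
  note e = labelling_edge_labels[of d l]
  obtain U b where U: "U \<in> carrier_mat d d" "det U dvd 1" "b \<in> carrier_vec d"
    and Ub: "\<And>x i. x \<in> carrier_vec d \<Longrightarrow> i < d \<Longrightarrow>
      (map_mat real_of_int U *\<^sub>v x + map_vec real_of_int b) $ i = transfer_map ?e (\<lambda>i. x $ i) i"
    using transfer_map_unimodular[OF e] by blast
  have "unimodularly_equivalent d (order_chain_polytope d l) (chain_polytope d ?Q)"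
  proof (rule unimodularly_equivalentI[OF U])
    fix x :: "real vec" assume x: "x \<in> carrier_vec d"
    let ?y = "map_mat real_of_int U *\<^sub>v x + map_vec real_of_int b"
    have "?y \<in> chain_polytope d ?Q \<longleftrightarrow> straight_run_ineqs d ?e (\<lambda>i. ?y $ i)"
      using U x by (simp add: chain_polytope_straightened_iff)
    also have "\<dots> \<longleftrightarrow> straight_run_ineqs d ?e (transfer_map ?e (\<lambda>i. x $ i))"
      by (rule straight_run_ineqs_cong) (rule Ub[OF x])
    also have "\<dots> \<longleftrightarrow> order_chain_ineqs d ?e (\<lambda>i. x $ i)"
      using straight_run_ineqs_transfer_map[OF _ e] order_chain_ineqs_if_transfer_map[OF _ e]
      by blast
    finally show "x \<in> order_chain_polytope d l \<longleftrightarrow> ?y \<in> chain_polytope d ?Q"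
      using x order_chain_polytope_iff[OF assms l] by simp
  qed (auto simp: order_chain_polytope_def chain_polytope_def)
  then show "\<exists>Q. zigzag_poset d Q \<and>
      unimodularly_equivalent d (order_chain_polytope d l) (chain_polytope d Q)"
    using zigzag_straightened_edges by blast
qed

end
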